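(* Let $X \in \mathbb{R}^{n_1\times n_2}$ be a matrix of rank $r$ with $X = U_1^{\#} G^{\#} (U_2^{\#})^\top$, where $G^{\#}\in\mathbb{R}^{r\times r}$ and, for $i\in\{1,2\}$, $U_i^{\#}\in\mathbb{R}^{n_i\times r}_+$ satisfies the SSC and $(U_i^{\#})^\top e = e$. Then this decomposition is essentially unique with respect to the optimization problem $$\min_{U_1\in\mathbb{R}^{n_1\times r},\,U_2\in\mathbb{R}^{n_2\times r},\,G\in\mathbb{R}^{r\times r}} |\det(G)| \quad\text{such that}\quad X = U_1 G U_2^\top,\ U_i^\top e = e,\ U_i\ge 0 \text{ for } i\in\{1,2\};$$ that is, for any optimal solution $(U_1^*,U_2^*,G^* )$ of this problem there exist $r\times r$ permutation matrices $\Pi_1,\Pi_2$ and (invertible) diagonal matrices $D_1,D_2$ such that $U_i^{\#} = U_i^*\Pi_i D_i$ for $i\in\{1,2\}$ and $G^{\#} = D_1^{-1}\Pi_1^\top G^* \Pi_2 D_2^{-1}$.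
   Context: $e$ is the all-ones vector of appropriate dimension, $e_k$ the $k$-th standard basis vector, and $\ge$ is entrywise. For $A\in\mathbb{R}^{m\times n}$, $\operatorname{cone}(A)=\{Ay : y\in\mathbb{R}^n, y\ge 0\}$ and $\operatorname{cone}^*(A)=\{y\in\mathbb{R}^m : A^\top y\ge 0\}$. A matrix $H\in\mathbb{R}^{n\times r}_+$ with $r\ge2$ satisfies the sufficiently scattered condition (SSC) if: (SSC1) $\{x\in\mathbb{R}^r_+ : e^\top x\ge\sqrt{r-1}\,\|x\|_2\}\subseteq\operatorname{cone}(H^\top)$; and (SSC2) $\operatorname{cone}^*(H^\top)\cap\operatorname{bd}(\mathcal{C}^* )=\{\lambda e_k : \lambda\ge0,\ k\in\{1,\dots,r\}\}$, where $\mathcal{C}^*=\{x\in\mathbb{R}^r : e^\top x\ge\|x\|_2\}$ and $\operatorname{bd}$ denotes the boundary. *)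

theory Defs
  imports "HOL-Analysis.Analysis"
begin

text \<open>
  A real matrix with \<open>m\<close> rows and \<open>n\<close> columns has type \<open>real^'n^'m\<close>. The order on vectors and
  matrices is the library's entrywise order, \<open>1 :: real^'n\<close> is the all-ones vector, and
  \<open>axis k 1\<close> is the \<open>k\<close>-th standard basis vector.
\<close>

definition matrix_cone :: "real^'n^'m \<Rightarrow> (real^'m) set" where
  "matrix_cone A = {A *v y | y. 0 \<le> y}"

definition matrix_dual_cone :: "real^'n^'m \<Rightarrow> (real^'m) set" where
  "matrix_dual_cone A = {y. 0 \<le> transpose A *v y}"

definition second_order_cone :: "(real^'r) set" where
  "second_order_cone = {x. norm x \<le> 1 \<bullet> x}"

definition SSC1 :: "real^'r^'n \<Rightarrow> bool" where
  "SSC1 H \<longleftrightarrow>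
     {x :: real^'r. 0 \<le> x \<and> sqrt (real CARD('r) - 1) * norm x \<le> 1 \<bullet> x} \<subseteq> matrix_cone (transpose H)"

definition SSC2 :: "real^'r^'n \<Rightarrow> bool" where
  "SSC2 H \<longleftrightarrow>
     matrix_dual_cone (transpose H) \<inter> frontier second_order_cone = {c *\<^sub>R axis k 1 | c k. 0 \<le> c}"

definition sufficiently_scattered :: "real^'r^'n \<Rightarrow> bool" where
  "sufficiently_scattered H \<longleftrightarrow> 2 \<le> CARD('r) \<and> 0 \<le> H \<and> SSC1 H \<and> SSC2 H"

definition feasible_trifactorization ::
    "real^'n2^'n1 \<Rightarrow> (real^'r^'n1) \<times> (real^'r^'n2) \<times> (real^'r^'r) \<Rightarrow> bool" where
  "feasible_trifactorization X = (\<lambda>(U1, U2, G).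
     X = U1 ** G ** transpose U2 \<and>
     transpose U1 *v 1 = 1 \<and> transpose U2 *v 1 = 1 \<and>
     0 \<le> U1 \<and> 0 \<le> U2)"

definition minimal_det_trifactorization ::
    "real^'n2^'n1 \<Rightarrow> (real^'r^'n1) \<times> (real^'r^'n2) \<times> (real^'r^'r) \<Rightarrow> bool" where
  "minimal_det_trifactorization X =
     is_arg_min (\<lambda>(U1, U2, G). \<bar>det G\<bar>) (feasible_trifactorization X)"

definition permutation_matrix :: "real^'r^'r \<Rightarrow> bool" where
  "permutation_matrix P \<longleftrightarrow>
     (\<exists>p. p permutes UNIV \<and> P = (\<chi> i j. if i = p j then 1 else 0))"

definition diagonal_matrix :: "real^'r^'r \<Rightarrow> bool" where
  "diagonal_matrix D \<longleftrightarrow> (\<forall>i j. i \<noteq> j \<longrightarrow> D $ i $ j = 0)"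

end

theory Submission
  imports Defs
begin

text \<open>
  Comparing column spaces gives \<open>U\<^sub>i' = U\<^sub>i A\<^sub>i\<close> with \<open>A\<^sub>i\<close> invertible and \<open>G = A\<^sub>1 G' A\<^sub>2\<^sup>T\<close>. The columns
  \<open>a\<close> of \<open>A\<^sub>i\<close> have entry sum \<open>1\<close> and satisfy \<open>U\<^sub>i a \<ge> 0\<close>, so SSC1 and conic duality bound their norm
  by their entry sum \<open>1\<close>, and \<open>|det A\<^sub>i| \<le> 1\<close> by Hadamard's inequality. Minimality of \<open>|det G'|\<close>
  forces \<open>|det A\<^sub>i| = 1\<close>, hence all columns of \<open>A\<^sub>i\<close> have norm \<open>1\<close> and lie on the boundary of the
  second-order cone; by SSC2 they are standard basis vectors, so \<open>A\<^sub>i\<close> is a permutation matrix.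
\<close>

section \<open>Hadamard's inequality\<close>

text \<open>One Gram-Schmidt step per element of \<open>S\<close>: removing from a row its
  projection onto the span of the rows already treated keeps the determinant and, by Pythagoras,
  cannot lengthen the row.\<close>

lemma orthogonalize_rows:
  fixes A :: "real^'n^'n"
  assumes "finite S"
  shows "\<exists>B. det B = det A \<and> (\<forall>i. norm (row i B) \<le> norm (row i A)) \<and>
             (\<forall>i\<in>S. \<forall>j\<in>S. i \<noteq> j \<longrightarrow> orthogonal (row i B) (row j B))"
  using assms
proof (induction S)
  case empty
  show ?case by auto
next
  case (insert k S)
  then obtain B where B: "det B = det A" "\<And>i. norm (row i B) \<le> norm (row i A)"
    "\<And>i j. i \<in> S \<Longrightarrow> j \<in> S \<Longrightarrow> i \<noteq> j \<Longrightarrow> orthogonal (row i B) (row j B)"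
    by blast
  let ?V = "(\<lambda>j. row j B) ` S"
  obtain y z where y: "y \<in> span ?V" and z: "\<And>w. w \<in> span ?V \<Longrightarrow> orthogonal z w"
    and yz: "row k B = y + z"
    using orthogonal_subspace_decomp_exists[of ?V "row k B"] by blast
  define C where "C = (\<chi> i. if i = k then row k B + (- y) else row i B)"
  have rows: "row i C = (if i = k then z else row i B)" for i
    using yz by (auto simp: C_def row_def vec_eq_iff)
  \<comment> \<open>Since \<open>k\<close> is not in \<open>S\<close>, the vector \<open>y\<close>
    is a combination of rows other than row \<open>k\<close>, so subtracting it is a
    determinant-preserving row operation.\<close>
  have "?V \<subseteq> {row j B |j. j \<noteq> k}"
    using insert.hyps by blast
  then have "- y \<in> span {row j B |j. j \<noteq> k}"
    using y span_mono span_neg by blast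
  then have "- y \<in> vec.span {row j B |j. j \<noteq> k}"
    by (simp add: span_vec_eq)
  then have "det C = det B"
    unfolding C_def by (rule det_row_span)
  moreover have "norm z \<le> norm (row k B)"
  proof -
    have "(norm (row k B))\<^sup>2 = (norm y)\<^sup>2 + (norm z)\<^sup>2"
      using norm_add_Pythagorean[of y z] z[OF y] yz by (simp add: orthogonal_commute)
    then show ?thesis
      by (smt (verit) norm_ge_zero power2_le_imp_le zero_le_power2)
  qed
  then have "norm (row i C) \<le> norm (row i A)" for i
    using B(2)[of i] by (auto simp: rows)
  moreover have "orthogonal z (row j B)" "orthogonal (row j B) z" if "j \<in> S" for j
    using that z[OF span_base] orthogonal_commute by blast+
  then have "orthogonal (row i C) (row j C)" if "i \<in> insert k S" "j \<in> insert k S" "i \<noteq> j" for i j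
    using that B(3) by (auto simp: rows)
  ultimately show ?case
    using B(1) by (intro exI[of _ C]) auto
qed

text \<open>For the orthogonalized matrix \<open>B\<close>, the product
  \<open>B ** transpose B\<close> is diagonal with the squared row norms as entries, so equality
  holds for \<open>B\<close>; passing from \<open>B\<close> back to \<open>A\<close> only enlarges
  the norms.\<close>

lemma hadamard_inequality:
  fixes A :: "real^'n^'n"
  shows "\<bar>det A\<bar> \<le> (\<Prod>i\<in>UNIV. norm (row i A))"
proof -
  obtain B where B: "det B = det A" "\<And>i. norm (row i B) \<le> norm (row i A)"
    "\<And>i j. i \<noteq> j \<Longrightarrow> orthogonal (row i B) (row j B)"
    using orthogonalize_rows[of UNIV A] by auto
  have "(det B)\<^sup>2 = det (B ** transpose B)"
    by (simp add: det_mul power2_eq_square)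
  also have "\<dots> = (\<Prod>i\<in>UNIV. (norm (row i B))\<^sup>2)"
    using B(3) by (subst det_diagonal)
      (auto simp: matrix_mult_transpose_dot_row orthogonal_def power2_norm_eq_inner)
  also have "\<dots> = (\<Prod>i\<in>UNIV. norm (row i B))\<^sup>2"
    by (simp add: prod_power_distrib)
  finally have "\<bar>det B\<bar> = \<bar>\<Prod>i\<in>UNIV. norm (row i B)\<bar>"
    by (simp only: power2_eq_iff abs_eq_iff)
  also have "\<dots> = (\<Prod>i\<in>UNIV. norm (row i B))"
    by (simp add: prod_nonneg)
  also have "\<dots> \<le> (\<Prod>i\<in>UNIV. norm (row i A))"
    using B(2) by (intro prod_mono) auto
  finally show ?thesis
    using B(1) by simp
qed

section \<open>The second-order cone\<close>

lemma inner_one_vec: "1 \<bullet> (x :: real^'n) = (\<Sum>i\<in>UNIV. x $ i)"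
  by (simp add: inner_vec_def one_vec_def)

lemma inner_one_one_vec: "1 \<bullet> (1 :: real^'n) = real CARD('n)"
  by (simp add: inner_one_vec)

text \<open>Here \<open>w $ i\<close> is also the inner product of \<open>w\<close> with the
  projection of \<open>axis i 1\<close> onto the hyperplane orthogonal to \<open>1\<close>. That
  projection has squared norm (r - 1) / r, and Cauchy-Schwarz gives the bound.\<close>

lemma abs_component_le_orthogonal_one:
  fixes w :: "real^'n"
  assumes "1 \<bullet> w = 0"
  shows "\<bar>w $ i\<bar> \<le> norm w * sqrt ((real CARD('n) - 1) / real CARD('n))"
proof -
  let ?r = "real CARD('n)"
  let ?u = "axis i 1 - (1 / ?r) *\<^sub>R (1 :: real^'n)"
  have r: "?r > 0" by simp
  have "w $ i = w \<bullet> ?u"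
    using assms by (simp add: inner_diff_right inner_axis inner_commute)
  moreover have "(norm ?u)\<^sup>2 = (?r - 1) / ?r"
  proof -
    have "1 \<bullet> (axis i 1 :: real^'n) = 1"
      by (simp add: inner_axis one_vec_def)
    then show ?thesis
      using r by (simp add: power2_norm_eq_inner inner_diff_left inner_diff_right
          inner_one_one_vec inner_axis_axis inner_commute[of "axis i 1" 1] field_simps)
  qed
  then have "norm ?u = sqrt ((?r - 1) / ?r)"
    by (metis norm_ge_zero real_sqrt_unique)
  ultimately show ?thesis
    using Cauchy_Schwarz_ineq2[of w ?u] by simp
qed

text \<open>
  With \<open>w\<close> the component of \<open>y\<close> orthogonal to the all-ones vector \<open>e\<close>, the worst test vector is the
  boundary ray \<open>\<alpha> e - w\<close> of the cone in SSC1, where \<open>\<alpha>\<^sup>2 = |w|\<^sup>2 (r - 1) / r\<close>.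
\<close>

lemma norm_le_inner_one_if_dual:
  fixes y :: "real^'r"
  assumes r2: "2 \<le> CARD('r)"
    and dual: "\<And>x :: real^'r. 0 \<le> x \<Longrightarrow> sqrt (real CARD('r) - 1) * norm x \<le> 1 \<bullet> x \<Longrightarrow> 0 \<le> y \<bullet> x"
  shows "norm y \<le> 1 \<bullet> y"
proof -
  define r where "r = real CARD('r)"
  have r: "r \<ge> 2" using r2 by (simp add: r_def)
  define s where "s = 1 \<bullet> y"
  define w where "w = y - (s / r) *\<^sub>R 1"
  define q where "q = sqrt ((r - 1) / r)"
  define \<alpha> where "\<alpha> = norm w * q"
  have q: "q > 0" "q\<^sup>2 = (r - 1) / r"
    using r by (auto simp: q_def)
  have ee: "1 \<bullet> (1 :: real^'r) = r"
    by (simp add: r_def inner_one_one_vec)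
  have ew: "1 \<bullet> w = 0"
    using r by (simp add: w_def inner_diff_right ee s_def)
  have ny: "(norm y)\<^sup>2 = s\<^sup>2 / r + (norm w)\<^sup>2"
  proof -
    have "y = (s / r) *\<^sub>R 1 + w" by (simp add: w_def)
    then have "y \<bullet> y = s\<^sup>2 / r + w \<bullet> w"
      using r by (simp add: inner_add_left inner_add_right ee ew inner_commute[of w 1] power2_eq_square)
    then show ?thesis
      by (simp add: power2_norm_eq_inner)
  qed
  \<comment> \<open>The all-ones vector is itself an admissible test vector; it fixes the sign of
    \<open>s\<close>, which the comparison of squares at the end needs.\<close>
  have "0 \<le> y \<bullet> 1"
  proof (rule dual)
    have "norm (1 :: real^'r) = sqrt r" by (simp add: norm_eq_sqrt_inner ee)
    moreover have "sqrt (r - 1) * sqrt r \<le> sqrt r * sqrt r"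
      using r by (intro mult_right_mono) auto
    ultimately show "sqrt (real CARD('r) - 1) * norm (1 :: real^'r) \<le> 1 \<bullet> (1 :: real^'r)"
      using r by (simp add: ee flip: r_def)
  qed (simp add: less_eq_vec_def one_vec_def)
  then have s: "s \<ge> 0" by (simp add: s_def inner_commute)
  have "0 \<le> y \<bullet> (\<alpha> *\<^sub>R 1 - w)"
  proof (rule dual)
    \<comment> \<open>\<open>\<alpha>\<close> is exactly the componentwise bound on
      \<open>w\<close>, which makes the test vector nonnegative; the cone inequality then holds with
      equality.\<close>
    have "\<bar>w $ i\<bar> \<le> \<alpha>" for i
      using abs_component_le_orthogonal_one[OF ew, of i] by (simp add: \<alpha>_def q_def r_def)
    then show "0 \<le> \<alpha> *\<^sub>R 1 - w"
      by (auto simp: less_eq_vec_def one_vec_def abs_le_iff)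
    have "(norm (\<alpha> *\<^sub>R 1 - w))\<^sup>2 = \<alpha>\<^sup>2 * r + (norm w)\<^sup>2"
      unfolding power2_norm_eq_inner
      by (simp add: inner_diff_left inner_diff_right ee ew inner_commute[of w 1] power2_eq_square)
    also have "\<dots> = r * (norm w)\<^sup>2"
      using r by (simp add: \<alpha>_def power_mult_distrib q field_simps)
    finally have "norm (\<alpha> *\<^sub>R 1 - w) = sqrt r * norm w"
      by (metis norm_ge_zero real_sqrt_mult real_sqrt_unique)
    moreover have "\<alpha> * r = sqrt (r - 1) * (sqrt r * norm w)"
      using r by (simp add: \<alpha>_def q_def real_sqrt_divide real_div_sqrt field_simps)
    ultimately show "sqrt (real CARD('r) - 1) * norm (\<alpha> *\<^sub>R 1 - w) \<le> 1 \<bullet> (\<alpha> *\<^sub>R 1 - w)"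
      by (simp add: inner_diff_right ee ew flip: r_def)
  qed
  also have "y \<bullet> (\<alpha> *\<^sub>R 1 - w) = \<alpha> * s - (norm w)\<^sup>2"
  proof -
    have "y \<bullet> w = w \<bullet> w"
      using ew by (simp add: w_def inner_diff_left)
    then show ?thesis
      by (simp add: inner_diff_right s_def inner_commute power2_norm_eq_inner)
  qed
  finally have "norm w * norm w \<le> norm w * (q * s)"
    by (simp add: \<alpha>_def power2_eq_square mult_ac)
  then have "norm w \<le> q * s"
    using q s by (cases "w = 0") auto
  \<comment> \<open>Adding the share s^2 / r of the all-ones direction yields exactly s^2.\<close>
  then have "(norm w)\<^sup>2 \<le> (r - 1) / r * s\<^sup>2"
    by (metis norm_ge_zero power_mono power_mult_distrib q(2))
  then have "(norm y)\<^sup>2 \<le> s\<^sup>2"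
    using r by (simp add: ny field_simps)
  then show ?thesis
    using power2_le_imp_le[OF _ s] s_def by blast
qed

text \<open>By SSC1 every test vector is \<open>z v* H\<close> with \<open>z\<close> nonnegative,
  and its pairing with \<open>y\<close> equals that of \<open>z\<close> with
  \<open>H *v y\<close>.\<close>

lemma SSC1_norm_le:
  fixes H :: "real^'r^'n" and y :: "real^'r"
  assumes "SSC1 H" and "2 \<le> CARD('r)" and y: "0 \<le> H *v y"
  shows "norm y \<le> 1 \<bullet> y"
proof (rule norm_le_inner_one_if_dual)
  fix x :: "real^'r"
  assume "0 \<le> x" "sqrt (real CARD('r) - 1) * norm x \<le> 1 \<bullet> x"
  then obtain z where z: "x = z v* H" "0 \<le> z"
    using assms(1) by (force simp: SSC1_def matrix_cone_def)
  have "y \<bullet> x = z \<bullet> (H *v y)"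
    by (metis z(1) dot_lmul_matrix inner_commute)
  also have "\<dots> \<ge> 0"
    using y z(2) by (auto simp: inner_vec_def less_eq_vec_def intro!: sum_nonneg)
  finally show "0 \<le> y \<bullet> x" .
qed fact

text \<open>Moving from \<open>a\<close> by -t along the all-ones direction lowers the entry sum by
  t r, but the inner product with the unit vector \<open>a\<close>, a lower bound for the norm, only
  by t. As r >= 2, the point leaves the cone for every t > 0.\<close>

lemma frontier_second_order_cone:
  fixes a :: "real^'r"
  assumes "2 \<le> CARD('r)" and "norm a = 1" and "1 \<bullet> a = 1"
  shows "a \<in> frontier second_order_cone"
proof -
  have a: "a \<in> second_order_cone"
    using assms by (simp add: second_order_cone_def)
  moreover have "a \<notin> interior second_order_cone"
  proof
    assume "a \<in> interior second_order_cone"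
    then obtain e where e: "e > 0" "ball a e \<subseteq> second_order_cone"
      by (auto simp: mem_interior)
    have n1: "norm (1 :: real^'r) > 0"
      by (simp add: norm_eq_sqrt_inner inner_one_one_vec)
    define t where "t = e / (2 * norm (1 :: real^'r))"
    have t: "t > 0" "t * norm (1 :: real^'r) < e"
      using e n1 by (auto simp: t_def)
    then have "a - t *\<^sub>R 1 \<in> ball a e"
      by (simp add: dist_norm)
    then have "a - t *\<^sub>R 1 \<in> second_order_cone"
      using e(2) by blast
    then have "norm (a - t *\<^sub>R 1) \<le> 1 \<bullet> (a - t *\<^sub>R 1)"
      by (simp add: second_order_cone_def)
    also have "\<dots> = 1 - t * real CARD('r)"
      using assms by (simp add: inner_diff_right inner_one_one_vec)
    also have "\<dots> < 1 - t"
      using t assms(1) by simp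
    also have "\<dots> = a \<bullet> (a - t *\<^sub>R 1)"
      using assms by (simp add: inner_diff_right inner_commute[of a 1] flip: power2_norm_eq_inner)
    also have "\<dots> \<le> norm (a - t *\<^sub>R 1)"
      using norm_cauchy_schwarz[of a "a - t *\<^sub>R 1"] assms by simp
    finally show False by simp
  qed
  ultimately show ?thesis
    using closure_subset by (auto simp: frontier_def)
qed

lemma SSC2_axis:
  fixes H :: "real^'r^'n" and a :: "real^'r"
  assumes "SSC2 H" and "2 \<le> CARD('r)" and "0 \<le> H *v a" and "norm a = 1" and "1 \<bullet> a = 1"
  shows "\<exists>k. a = axis k 1"
proof -
  have "a \<in> matrix_dual_cone (transpose H) \<inter> frontier second_order_cone"
    using assms frontier_second_order_cone[of a] by (simp add: matrix_dual_cone_def)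
  then obtain c k where "a = c *\<^sub>R axis k 1" "0 \<le> c"
    using assms(1) unfolding SSC2_def by blast
  then show ?thesis
    using assms(4) by auto
qed

section \<open>Factorizations of full rank\<close>

text \<open>The rank of a product is at most that of each factor, and the inner dimension caps both,
  so both factors have full rank.\<close>

lemma full_rank_factor_inverses:
  fixes U :: "real^'r^'m" and M :: "real^'n^'r"
  assumes "rank (U ** M) = CARD('r)"
  shows "\<exists>L. L ** U = mat 1" and "\<exists>R. M ** R = mat 1"
proof -
  have "rank U = CARD('r)" "rank M = CARD('r)"
    using assms rank_mul_le_left[of U M] rank_mul_le_right[of U M] rank_bound[of U] rank_bound[of M]
    by auto
  then show "\<exists>L. L ** U = mat 1" "\<exists>R. M ** R = mat 1"
    by (simp_all add: matrix_left_invertible_injective full_rank_injective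
        matrix_right_invertible_surjective full_rank_surjective)
qed

lemma full_rank_factorizations_related:
  fixes U U' :: "real^'r^'m" and M M' :: "real^'n^'r"
  assumes eq: "U ** M = U' ** M'" and rk: "rank (U ** M) = CARD('r)"
  obtains A where "invertible A" and "U' = U ** A" and "M = A ** M'"
proof -
  obtain L where L: "L ** U = mat 1"
    using full_rank_factor_inverses(1)[OF rk] by blast
  obtain L' R' where L': "L' ** U' = mat 1" and R': "M' ** R' = mat 1"
    using full_rank_factor_inverses[of U' M'] rk eq by metis
  \<comment> \<open>Multiplying \<open>U ** M = U' ** M'\<close> on the right by \<open>R'\<close>
    isolates \<open>U'\<close>, which dictates this choice.\<close>
  define A where "A = M ** R'"
  have U': "U' = U ** A"
    unfolding A_def by (metis R' eq matrix_mul_assoc matrix_mul_rid)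
  have "L' ** U ** A = mat 1"
    using L' U' by (simp add: matrix_mul_assoc)
  then have "invertible A"
    using invertible_left_inverse by blast
  moreover have "M = A ** M'"
    by (metis L U' eq matrix_mul_assoc matrix_mul_lid)
  ultimately show thesis
    using that U' by blast
qed

section \<open>Permutation matrices\<close>

text \<open>The transpose belongs to the inverse permutation. The columns are distinct standard
  basis vectors, hence orthonormal, and a one-sided inverse of a square matrix is two-sided.\<close>

lemma permutation_matrix_transpose:
  assumes "permutation_matrix P"
  shows "permutation_matrix (transpose P)" and "P ** transpose P = mat 1"
proof -
  obtain p where p: "p permutes UNIV" "P = (\<chi> i j. if i = p j then 1 else 0)"
    using assms by (auto simp: permutation_matrix_def)
  have "j = p i \<longleftrightarrow> i = inv p j" for i j
    using permutes_inv_eq[OF p(1)] by metis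
  then have "transpose P = (\<chi> i j. if i = inv p j then 1 else 0)"
    by (simp add: p(2) transpose_def vec_eq_iff)
  then show "permutation_matrix (transpose P)"
    using permutes_inv[OF p(1)] by (auto simp: permutation_matrix_def)
  have "column i P = axis (p i) 1" for i
    by (auto simp: p(2) column_def axis_def vec_eq_iff)
  then have "column i P \<bullet> column j P = (if i = j then 1 else 0)" for i j
    using permutes_inj[OF p(1)] by (simp add: inner_axis_axis inj_eq)
  then have "transpose P ** P = mat 1"
    by (simp add: matrix_mult_transpose_dot_column mat_def)
  then show "P ** transpose P = mat 1"
    using matrix_left_right_inverse by blast
qed

text \<open>Invertibility rules out equal columns, so the index map \<open>p\<close> is injective
  and, on a finite type, a permutation.\<close>

lemma permutation_matrix_if_columns_axis:
  fixes A :: "real^'r^'r"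
  assumes "invertible A" and "\<And>k. \<exists>i. column k A = axis i 1"
  shows "permutation_matrix A"
proof -
  obtain p where p: "\<And>k. column k A = axis (p k) 1"
    using assms(2) by metis
  have "inj p"
  proof
    fix j k assume "p j = p k"
    then have "A *v axis j 1 = A *v axis k 1"
      by (simp add: p matrix_vector_mult_basis)
    then have "axis j (1::real) = axis k 1"
      using inj_matrix_vector_mult[OF assms(1)] by (simp add: inj_eq)
    then show "j = k"
      by (simp add: axis_eq_axis)
  qed
  then have "p permutes UNIV"
    by (simp add: permutes_def bij_iff[symmetric] bij_def finite_UNIV_inj_surj)
  moreover have "A $ i $ j = (if i = p j then 1 else 0)" for i j
    using p[of j] by (auto simp: column_def axis_def vec_eq_iff)
  then have "A = (\<chi> i j. if i = p j then 1 else 0)"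
    by (simp add: vec_eq_iff)
  ultimately show ?thesis
    by (auto simp: permutation_matrix_def)
qed

section \<open>Uniqueness\<close>

lemma prod_le_1_factor:
  fixes f :: "'a :: finite \<Rightarrow> real"
  assumes "\<And>i. 0 \<le> f i" and "\<And>i. f i \<le> 1" and "1 \<le> (\<Prod>i\<in>UNIV. f i)"
  shows "f k = 1"
proof -
  have "(\<Prod>i\<in>UNIV. f i) = f k * (\<Prod>i\<in>UNIV - {k}. f i)"
    by (simp add: prod.remove)
  also have "\<dots> \<le> f k * 1"
    using assms by (intro mult_left_mono prod_le_1) auto
  finally show ?thesis
    using assms(2)[of k] assms(3) by simp
qed

text \<open>Treats one factor at a time: \<open>A\<close> is the change of basis from the scattered
  factor \<open>U\<close> to a competing feasible factor \<open>U ** A\<close>.\<close>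

lemma sufficiently_scattered_mixing:
  fixes U :: "real^'r^'n" and A :: "real^'r^'r"
  assumes ss: "sufficiently_scattered U"
    and U: "transpose U *v 1 = 1" and UA: "transpose (U ** A) *v 1 = 1" and pos: "0 \<le> U ** A"
  shows "\<bar>det A\<bar> \<le> 1"
    and "invertible A \<Longrightarrow> \<bar>det A\<bar> = 1 \<Longrightarrow> permutation_matrix A"
proof -
  have r: "2 \<le> CARD('r)" and ssc: "SSC1 U" "SSC2 U"
    using ss by (auto simp: sufficiently_scattered_def)
  have "transpose A *v 1 = 1"
    using U UA by (metis matrix_transpose_mul matrix_vector_mul_assoc)
  moreover have "1 \<bullet> column k A = (transpose A *v 1) $ k" for k
    by (simp add: inner_vec_def vector_matrix_mult_def column_def)
  ultimately have sum1: "1 \<bullet> column k A = 1" for k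
    by (metis one_index)
  have dual: "0 \<le> U *v column k A" for k
    using pos by (simp add: less_eq_vec_def matrix_matrix_mult_def matrix_vector_mult_def column_def)
  have le1: "norm (column k A) \<le> 1" for k
    using SSC1_norm_le[OF ssc(1) r dual] sum1 by metis
  have had: "\<bar>det A\<bar> \<le> (\<Prod>k\<in>UNIV. norm (column k A))"
    using hadamard_inequality[of "transpose A"] by simp
  also have "\<dots> \<le> 1"
    using le1 by (intro prod_le_1) auto
  finally show "\<bar>det A\<bar> \<le> 1" .
  assume "invertible A" "\<bar>det A\<bar> = 1"
  \<comment> \<open>Equality in the determinant bound: the column norms are at most 1 while their
    product is at least 1.\<close>
  moreover from this had have "norm (column k A) = 1" for k
    using le1 by (intro prod_le_1_factor[of "\<lambda>k. norm (column k A)"]) auto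
  then have "\<exists>i. column k A = axis i 1" for k
    using SSC2_axis[OF ssc(2) r dual] sum1 by blast
  ultimately show "permutation_matrix A"
    using permutation_matrix_if_columns_axis by blast
qed

theorem theorem4p2:
  fixes X :: "real^'n2^'n1"
    and U1 :: "real^'r^'n1" and U2 :: "real^'r^'n2" and G :: "real^'r^'r"
    and U1' :: "real^'r^'n1" and U2' :: "real^'r^'n2" and G' :: "real^'r^'r"
  assumes "rank X = CARD('r)"
    and "X = U1 ** G ** transpose U2"
    and "sufficiently_scattered U1" and "sufficiently_scattered U2"
    and "transpose U1 *v 1 = 1" and "transpose U2 *v 1 = 1"
    and "minimal_det_trifactorization X (U1', U2', G')"
  shows "\<exists>P1 P2 D1 D2 :: real^'r^'r.
           permutation_matrix P1 \<and> permutation_matrix P2 \<and>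
           diagonal_matrix D1 \<and> invertible D1 \<and> diagonal_matrix D2 \<and> invertible D2 \<and>
           U1 = U1' ** P1 ** D1 \<and> U2 = U2' ** P2 ** D2 \<and>
           G = matrix_inv D1 ** transpose P1 ** G' ** P2 ** matrix_inv D2"
proof -
  have feas: "X = U1' ** G' ** transpose U2'" "transpose U1' *v 1 = 1" "transpose U2' *v 1 = 1"
      "0 \<le> U1'" "0 \<le> U2'"
    using assms(7)
    by (auto simp: minimal_det_trifactorization_def is_arg_min_def feasible_trifactorization_def)
  have "feasible_trifactorization X (U1, U2, G)"
    using assms by (auto simp: feasible_trifactorization_def sufficiently_scattered_def)
  then have opt: "\<bar>det G'\<bar> \<le> \<bar>det G\<bar>"
    using assms(7) by (force simp: minimal_det_trifactorization_def is_arg_min_def)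
  have rk: "rank (U1 ** (G ** transpose U2)) = CARD('r)"
    using assms(1,2) by (simp add: matrix_mul_assoc)
  obtain A where A: "invertible A" "U1' = U1 ** A"
      and GA: "G ** transpose U2 = A ** (G' ** transpose U2')"
  proof (rule full_rank_factorizations_related[OF _ rk, where U' = U1' and M' = "G' ** transpose U2'"])
    show "U1 ** (G ** transpose U2) = U1' ** (G' ** transpose U2')"
      using assms(2) feas(1) by (simp add: matrix_mul_assoc)
  qed
  \<comment> \<open>Transposing \<open>X\<close> puts the second factor on the left, so the same
    comparison of column spaces applies to it.\<close>
  have XT: "transpose X = U2 ** (transpose G ** transpose U1)"
    by (subst assms(2)) (simp add: matrix_transpose_mul)
  have XT': "transpose X = U2' ** (transpose G' ** transpose U1')"
    by (subst feas(1)) (simp add: matrix_transpose_mul)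
  have rkT: "rank (U2 ** (transpose G ** transpose U1)) = CARD('r)"
    using assms(1) by (simp add: rank_transpose flip: XT)
  obtain B where B: "invertible B" "U2' = U2 ** B"
    using full_rank_factorizations_related[OF trans[OF XT[symmetric] XT'] rkT] by metis
  obtain L where L: "L ** U2 = mat 1"
    using full_rank_factor_inverses(1)[OF rkT] by blast
  \<comment> \<open>The left inverse of \<open>U2\<close>, transposed, cancels
    \<open>transpose U2\<close> on both sides and leaves the relation between the cores
    \<open>G\<close> and \<open>G'\<close>.\<close>
  have "G ** transpose U2 ** transpose L = A ** G' ** transpose B ** transpose U2 ** transpose L"
    by (simp add: GA B(2) matrix_transpose_mul matrix_mul_assoc)
  moreover have "transpose U2 ** transpose L = mat 1"
    using L by (metis matrix_transpose_mul transpose_mat)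
  ultimately have G: "G = A ** G' ** transpose B"
    by (metis matrix_mul_assoc matrix_mul_rid)
  \<comment> \<open>Nonsingularity of \<open>G'\<close> allows its determinant to be divided out of
    the minimality inequality.\<close>
  have "rank G' = CARD('r)"
    using assms(1) rank_mul_le_left[of "U1' ** G'" "transpose U2'"] rank_mul_le_right[of U1' G']
      rank_bound[of G'] feas(1) by simp
  then have det0: "\<bar>det G'\<bar> > 0"
    using rank_bound[of G'] by (simp add: det_eq_0_rank)
  note mixA = sufficiently_scattered_mixing[OF assms(3,5), of A, folded A(2), OF feas(2,4)]
  note mixB = sufficiently_scattered_mixing[OF assms(4,6), of B, folded B(2), OF feas(3,5)]
  have "1 \<le> \<bar>det A\<bar> * \<bar>det B\<bar>"
    using opt det0 by (simp add: G det_mul abs_mult)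
  \<comment> \<open>Two numbers in [0, 1] whose product is at least 1 are both 1.\<close>
  moreover have "\<bar>det A\<bar> * \<bar>det B\<bar> \<le> \<bar>det A\<bar>" "\<bar>det A\<bar> * \<bar>det B\<bar> \<le> \<bar>det B\<bar>"
    using mixA(1) mixB(1) by (simp_all add: mult_left_le mult_left_le_one_le)
  ultimately have PA: "permutation_matrix A" and PB: "permutation_matrix B"
    using mixA mixB A(1) B(1) by auto
  have "U1 = U1' ** transpose A" "U2 = U2' ** transpose B"
    using permutation_matrix_transpose(2)[OF PA] permutation_matrix_transpose(2)[OF PB]
    by (simp_all add: A(2) B(2) flip: matrix_mul_assoc)
  moreover have "matrix_inv (mat 1 :: real^'r^'r) = mat 1"
    unfolding matrix_inv_def by (rule some_equality) auto
  moreover have "invertible (mat 1 :: real^'r^'r)"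
    unfolding invertible_def by (rule exI[of _ "mat 1"]) simp
  moreover have "diagonal_matrix (mat 1 :: real^'r^'r)"
    by (simp add: diagonal_matrix_def mat_def)
  \<comment> \<open>The permutations are the inverses \<open>transpose A\<close> and
    \<open>transpose B\<close>. The diagonal matrices can be the identity because the column sums of
    all factors are normalized to 1.\<close>
  ultimately show ?thesis
    using permutation_matrix_transpose(1)[OF PA] permutation_matrix_transpose(1)[OF PB] G
    by (rule_tac exI[of _ "transpose A"], rule_tac exI[of _ "transpose B"],
        rule_tac exI[of _ "mat 1"], rule_tac exI[of _ "mat 1"]) simp
qed

end
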